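(* Let $R>0$ and let $B(R)\subset\mathbb{R}^2$ be the Euclidean disk of radius $R$ centered at the origin, with Cartesian coordinates $(u,v)$. The two-wave saddle $\omega_1(u,v)=\frac12(u^2-v^2)$ is a global minimum of the bending energy $$\mathfrak{B}[\omega]=\int_{B(R)}\|D^2\omega\|^2\,du\,dv$$ over all solutions $\omega\in W^{2,2}(B(R))$ of the hyperbolic Monge–Ampère equation $$\frac{\partial^2\omega}{\partial u^2}\frac{\partial^2\omega}{\partial v^2}-\left(\frac{\partial^2\omega}{\partial u\,\partial v}\right)^2=-1 .$$ That is, $\omega_1$ solves this equation and $\mathfrak{B}[\omega_1]\le\mathfrak{B}[\omega]$ for every $\omega\in W^{2,2}(B(R))$ satisfying it.
   Context: $\|D^2\omega\|$ denotes the Frobenius norm of the Hessian matrix, so $\|D^2\omega\|^2=k_1^2+k_2^2$ with $k_1,k_2$ the eigenvalues of $D^2\omega$. For $\omega\in W^{2,2}(B(R))$ the Monge–Ampère equation is understood to hold almost everywhere in $B(R)$. *)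

theory Defs
  imports "HOL-Analysis.Analysis"
begin

definition partial :: "'n::finite \<Rightarrow> (real^'n \<Rightarrow> real) \<Rightarrow> real^'n \<Rightarrow> real" where
  "partial i f x = frechet_derivative f (at x) (axis i 1)"

text \<open>A list of coordinate directions plays the role of a multi-index; its length is the order.\<close>

fun partials :: "'n::finite list \<Rightarrow> (real^'n \<Rightarrow> real) \<Rightarrow> real^'n \<Rightarrow> real" where
  "partials [] f = f"
| "partials (i # \<alpha>) f = partial i (partials \<alpha> f)"

text \<open>Differentiability of every iterated partial derivative also gives its continuity, so this
  is the class of infinitely often continuously differentiable functions.\<close>

definition smooth :: "(real^'n::finite \<Rightarrow> real) \<Rightarrow> bool" where
  "smooth f \<longleftrightarrow> (\<forall>\<alpha>. partials \<alpha> f differentiable_on UNIV)"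

definition test_functions :: "(real^'n::finite) set \<Rightarrow> (real^'n \<Rightarrow> real) set" where
  "test_functions \<Omega> =
     {\<phi>. smooth \<phi> \<and> compact (closure {x. \<phi> x \<noteq> 0}) \<and> closure {x. \<phi> x \<noteq> 0} \<subseteq> \<Omega>}"

definition locally_integrable_on ::
    "(real^'n::finite \<Rightarrow> real) \<Rightarrow> (real^'n) set \<Rightarrow> bool" where
  "locally_integrable_on f \<Omega> \<longleftrightarrow>
     (\<forall>K. compact K \<and> K \<subseteq> \<Omega> \<longrightarrow> integrable (lebesgue_on K) f)"

definition L2_on :: "(real^'n::finite) set \<Rightarrow> (real^'n \<Rightarrow> real) set" where
  "L2_on \<Omega> = {f. f \<in> borel_measurable (lebesgue_on \<Omega>) \<and>
                 integrable (lebesgue_on \<Omega>) (\<lambda>x. (f x)\<^sup>2)}"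

definition has_weak_deriv ::
    "(real^'n::finite) set \<Rightarrow> 'n list \<Rightarrow> (real^'n \<Rightarrow> real) \<Rightarrow> (real^'n \<Rightarrow> real) \<Rightarrow> bool" where
  "has_weak_deriv \<Omega> \<alpha> f g \<longleftrightarrow>
     locally_integrable_on f \<Omega> \<and> locally_integrable_on g \<Omega> \<and>
     (\<forall>\<phi>\<in>test_functions \<Omega>.
        (\<integral>x. f x * partials \<alpha> \<phi> x \<partial>lebesgue_on \<Omega>)
          = (-1) ^ length \<alpha> * (\<integral>x. g x * \<phi> x \<partial>lebesgue_on \<Omega>))"

text \<open>The Sobolev space \<open>W\<^sup>k\<^sup>,\<^sup>2\<close> on an open set. Its elements are represented by
  functions on the whole space, whose values outside the open set are irrelevant.\<close>

definition sobolev_W2 :: "nat \<Rightarrow> (real^'n::finite) set \<Rightarrow> (real^'n \<Rightarrow> real) set" where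
  "sobolev_W2 k \<Omega> = {f \<in> L2_on \<Omega>.
     \<forall>\<alpha>. length \<alpha> \<le> k \<longrightarrow> (\<exists>g\<in>L2_on \<Omega>. has_weak_deriv \<Omega> \<alpha> f g)}"

text \<open>A representative of the weak derivative. It is determined only up to a null set
  (and is meaningful only where a weak derivative exists), so it should occur only inside
  integrals and almost-everywhere statements.\<close>

definition weak_deriv ::
    "(real^'n::finite) set \<Rightarrow> 'n list \<Rightarrow> (real^'n \<Rightarrow> real) \<Rightarrow> real^'n \<Rightarrow> real" where
  "weak_deriv \<Omega> \<alpha> f = (SOME g. has_weak_deriv \<Omega> \<alpha> f g)"

definition weak_hessian ::
    "(real^'n::finite) set \<Rightarrow> (real^'n \<Rightarrow> real) \<Rightarrow> real^'n \<Rightarrow> real^'n^'n" where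
  "weak_hessian \<Omega> f x = (\<chi> i j. weak_deriv \<Omega> [i, j] f x)"

text \<open>The norm of the type \<open>real^'n^'n\<close> is the Frobenius norm.\<close>

lemma norm_matrix_frobenius:
  fixes A :: "real^'n::finite^'m::finite"
  shows "(norm A)\<^sup>2 = (\<Sum>i\<in>UNIV. \<Sum>j\<in>UNIV. (A $ i $ j)\<^sup>2)"
  by (simp add: norm_vec_def L2_set_def sum_nonneg)

definition bending_energy :: "real \<Rightarrow> (real^2 \<Rightarrow> real) \<Rightarrow> real" where
  "bending_energy R \<omega> =
     (\<integral>x. (norm (weak_hessian (ball 0 R) \<omega> x))\<^sup>2 \<partial>lebesgue_on (ball 0 R))"

text \<open>The coordinates \<open>u\<close> and \<open>v\<close> of a point \<open>x\<close> are \<open>x $ 1\<close> and \<open>x $ 2\<close>.\<close>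

definition solves_monge_ampere :: "real \<Rightarrow> (real^2 \<Rightarrow> real) \<Rightarrow> bool" where
  "solves_monge_ampere R \<omega> \<longleftrightarrow>
     (AE x in lebesgue_on (ball 0 R).
        weak_deriv (ball 0 R) [1, 1] \<omega> x * weak_deriv (ball 0 R) [2, 2] \<omega> x
          - (weak_deriv (ball 0 R) [1, 2] \<omega> x)\<^sup>2 = -1)"

definition two_wave_saddle :: "real^2 \<Rightarrow> real" where
  "two_wave_saddle x = ((x $ 1)\<^sup>2 - (x $ 2)\<^sup>2) / 2"

end

theory Submission
  imports Defs "HOL-Computational_Algebra.Polynomial"
begin

text \<open>Writing \<open>a\<close>, \<open>b\<close>, \<open>c\<close> for the entries of a symmetric Hessian with \<open>a c - b\<^sup>2 = -1\<close>, the
  Frobenius norm satisfies \<open>a\<^sup>2 + 2 b\<^sup>2 + c\<^sup>2 = (a + c)\<^sup>2 + 2 \<ge> 2\<close>, with equality for the saddle; the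
  estimate is then integrated. Symmetry of the weak Hessian comes from the symmetry of second
  derivatives of test functions, and weak derivatives are unique almost everywhere because
  indicators of boxes are bounded pointwise limits of test functions.\<close>

section \<open>Partial derivatives of smooth functions\<close>

text \<open>The quantity \<open>a + c\<close> is the Laplacian, so pointwise equality holds exactly
  where the Laplacian vanishes. The saddle is harmonic, and the comparison is therefore purely
  pointwise, with no variational equation. The labour lies elsewhere: \<open>weak_deriv\<close> is
  an arbitrary choice among all weak derivatives. Neither its values for the saddle nor its square
  integrability for a competitor can be read off before two weak derivatives are known to agree
  almost everywhere. Square integrability is essential: the Bochner integral of a non-integrable
  function is 0 by default, so a competitor with infinite energy would appear to beat the saddle.
  Membership in \<open>sobolev_W2\<close> excludes this.\<close>

lemma partial_eqI: "(f has_derivative f') (at x) \<Longrightarrow> partial i f x = f' (axis i 1)"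
  unfolding partial_def by (metis frechet_derivative_at)

text \<open>Restriction to a coordinate line, so that the one-variable mean value theorem can be
  applied to \<open>partial\<close>.\<close>

lemma partial_has_real_derivative:
  fixes f :: "real^'n::finite \<Rightarrow> real"
  assumes "f differentiable (at (x + t *\<^sub>R axis i 1))"
  shows "((\<lambda>t. f (x + t *\<^sub>R axis i 1)) has_real_derivative partial i f (x + t *\<^sub>R axis i 1)) (at t)"
proof -
  let ?f' = "frechet_derivative f (at (x + t *\<^sub>R axis i 1))"
  have d: "(f has_derivative ?f') (at (x + t *\<^sub>R axis i 1))"
    using assms by (simp add: frechet_derivative_works)
  have "((\<lambda>t. x + t *\<^sub>R axis i 1) has_derivative (\<lambda>h. h *\<^sub>R axis i 1)) (at t)"
    by (auto intro!: derivative_eq_intros)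
  from has_derivative_compose[OF this, of f ?f'] d
  have "((\<lambda>t. f (x + t *\<^sub>R axis i 1)) has_derivative (\<lambda>h. ?f' (h *\<^sub>R axis i 1))) (at t)"
    by simp
  moreover have "(\<lambda>h. ?f' (h *\<^sub>R axis i 1)) = (\<lambda>h. partial i f (x + t *\<^sub>R axis i 1) * h)"
    using has_derivative_linear[OF d] by (auto simp: partial_def linear_cmul mult.commute)
  ultimately show ?thesis
    by (simp add: has_field_derivative_def)
qed

lemma partial_add:
  assumes "f differentiable (at x)" "g differentiable (at x)"
  shows "partial i (\<lambda>x. f x + g x) x = partial i f x + partial i g x"
  using has_derivative_add[of f "frechet_derivative f (at x)" "at x" g "frechet_derivative g (at x)"] assms
  by (subst partial_eqI) (auto simp: frechet_derivative_works partial_def)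

lemma partial_mult:
  fixes f g :: "real^'n::finite \<Rightarrow> real"
  assumes "f differentiable (at x)" "g differentiable (at x)"
  shows "partial i (\<lambda>x. f x * g x) x = f x * partial i g x + partial i f x * g x"
  using has_derivative_mult[of f "frechet_derivative f (at x)" x UNIV g "frechet_derivative g (at x)"] assms
  by (subst partial_eqI) (auto simp: frechet_derivative_works partial_def)

lemma partial_const: "partial i (\<lambda>x. c) = (\<lambda>x. 0)"
  by (rule ext, subst partial_eqI[OF has_derivative_const]) simp

lemma partial_coord: "partial i (\<lambda>x. x $ j) = (\<lambda>x. if i = j then 1 else 0)"
  by (rule ext, subst partial_eqI[OF bounded_linear_imp_has_derivative[OF bounded_linear_vec_nth]])
     (simp add: axis_def)

lemma smooth_differentiable: "smooth f \<Longrightarrow> partials \<alpha> f differentiable (at x)"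
  by (auto simp: smooth_def differentiable_on_def)

lemma smooth_continuous_on: "smooth f \<Longrightarrow> continuous_on S (partials \<alpha> f)"
  using smooth_def differentiable_imp_continuous_on continuous_on_subset by blast

lemma partials_append: "partials (\<alpha> @ \<beta>) f = partials \<alpha> (partials \<beta> f)"
  by (induction \<alpha>) auto

lemma smooth_partials: "smooth f \<Longrightarrow> smooth (partials \<alpha> f)"
  unfolding smooth_def by (metis partials_append)

text \<open>The complement of the support is open, so a function vanishing there vanishes near each
  of its points, and its derivative does too. The closure is essential: at an isolated zero the
  derivative may be nonzero.\<close>

lemma partials_eq_0_outside_support:
  assumes "x \<notin> closure {x. f x \<noteq> 0}"
  shows "partials \<alpha> f x = 0"
  using assms
proof (induction \<alpha> arbitrary: x)
  case Nil
  then show ?case using closure_subset[of "{x. f x \<noteq> 0}"] by auto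
next
  case (Cons i \<alpha>)
  let ?U = "- closure {x. f x \<noteq> 0}"
  have "(partials \<alpha> f has_derivative (\<lambda>h. 0)) (at x)"
  proof (rule has_derivative_transform_within_open)
    show "((\<lambda>x. 0) has_derivative (\<lambda>h. 0)) (at x)" by simp
    show "open ?U" by auto
    show "x \<in> ?U" using Cons.prems by simp
    show "0 = partials \<alpha> f y" if "y \<in> ?U" for y using Cons.IH[of y] that by simp
  qed
  then show ?case by (simp add: partial_eqI)
qed

text \<open>Two applications of the mean value theorem, in direction \<open>i\<close> and then in
  direction \<open>j\<close>. The left side is symmetric in \<open>i\<close> and \<open>j\<close>,
  the right side is not; this is what yields the equality of mixed partials.\<close>

lemma smooth_second_difference:
  fixes f :: "real^'n::finite \<Rightarrow> real"
  assumes f: "smooth f" and h: "h > 0"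
  shows "\<exists>s t. 0 < s \<and> s < h \<and> 0 < t \<and> t < h \<and>
    f (x + h *\<^sub>R axis i 1 + h *\<^sub>R axis j 1) - f (x + h *\<^sub>R axis i 1) - f (x + h *\<^sub>R axis j 1) + f x
     = h * (h * partials [j, i] f (x + s *\<^sub>R axis i 1 + t *\<^sub>R axis j 1))"
proof -
  have d: "f differentiable (at y)" "partial i f differentiable (at y)" for y
    using smooth_differentiable[OF f, of "[]"] smooth_differentiable[OF f, of "[i]"] by auto
  \<comment> \<open>The increment of \<open>g\<close> over \<open>[0, h]\<close> is the second
    difference, and the derivative of \<open>g\<close> is a difference of two values of
    \<open>partial i f\<close>, ready for the second application.\<close>
  define g where "g = (\<lambda>t. f (x + h *\<^sub>R axis j 1 + t *\<^sub>R axis i 1) - f (x + t *\<^sub>R axis i 1))"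
  have "\<exists>s. 0 < s \<and> s < h \<and> g h - g 0 = (h - 0) *
     (partial i f (x + h *\<^sub>R axis j 1 + s *\<^sub>R axis i 1) - partial i f (x + s *\<^sub>R axis i 1))"
    unfolding g_def by (rule MVT2[OF h]) (intro DERIV_diff partial_has_real_derivative d)
  then obtain s where s: "0 < s" "s < h" "g h - g 0 = h *
     (partial i f (x + h *\<^sub>R axis j 1 + s *\<^sub>R axis i 1) - partial i f (x + s *\<^sub>R axis i 1))" by auto
  have "\<exists>t. 0 < t \<and> t < h \<and> partial i f (x + s *\<^sub>R axis i 1 + h *\<^sub>R axis j 1)
       - partial i f (x + s *\<^sub>R axis i 1 + 0 *\<^sub>R axis j 1)
     = (h - 0) * partial j (partial i f) (x + s *\<^sub>R axis i 1 + t *\<^sub>R axis j 1)"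
    by (rule MVT2[OF h]) (intro partial_has_real_derivative d)
  then obtain t where t: "0 < t" "t < h" "partial i f (x + s *\<^sub>R axis i 1 + h *\<^sub>R axis j 1)
       - partial i f (x + s *\<^sub>R axis i 1)
     = h * partial j (partial i f) (x + s *\<^sub>R axis i 1 + t *\<^sub>R axis j 1)" by auto
  have c: "x + h *\<^sub>R axis j 1 + s *\<^sub>R axis i 1 = x + s *\<^sub>R axis i 1 + h *\<^sub>R axis j 1"
     "x + h *\<^sub>R axis j 1 + h *\<^sub>R axis i 1 = x + h *\<^sub>R axis i 1 + h *\<^sub>R axis j 1"
    by (simp_all add: algebra_simps)
  have "f (x + h *\<^sub>R axis i 1 + h *\<^sub>R axis j 1) - f (x + h *\<^sub>R axis i 1) - f (x + h *\<^sub>R axis j 1) + f x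
    = g h - g 0" by (simp add: g_def c)
  with s t c show ?thesis by auto
qed

text \<open>Schwarz's theorem: the same second difference equals \<open>h^2\<close> times either
  mixed partial, each taken at some point that tends to \<open>x\<close> with \<open>h\<close>.
  Dividing by \<open>h^2\<close> and using continuity of both partials identifies the
  limits.\<close>

lemma partials_commute:
  fixes f :: "real^'n::finite \<Rightarrow> real"
  assumes f: "smooth f"
  shows "partials [i, j] f = partials [j, i] f"
proof
  fix x
  define h :: "nat \<Rightarrow> real" where "h n = inverse (real (Suc n))" for n
  have h: "h n > 0" for n by (simp add: h_def)
  have h0: "h \<longlonglongrightarrow> 0" unfolding h_def by (rule LIMSEQ_inverse_real_of_nat)
  define D where "D k l n s t \<longleftrightarrow> 0 < s \<and> s < h n \<and> 0 < t \<and> t < h n \<and>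
    f (x + h n *\<^sub>R axis k 1 + h n *\<^sub>R axis l 1) - f (x + h n *\<^sub>R axis k 1) - f (x + h n *\<^sub>R axis l 1) + f x
     = h n * (h n * partials [l, k] f (x + s *\<^sub>R axis k 1 + t *\<^sub>R axis l 1))" for k l n s t
  have D: "\<exists>s t. D k l n s t" for k l n
    unfolding D_def by (rule smooth_second_difference[OF f h])
  obtain s t where "\<And>n. D i j n (s n) (t n)"
    using D[of i j] by metis
  note st = this[unfolded D_def]
  obtain s' t' where "\<And>n. D j i n (s' n) (t' n)"
    using D[of j i] by metis
  note st' = this[unfolded D_def]
  have c: "x + h n *\<^sub>R axis j 1 + h n *\<^sub>R axis i 1 = x + h n *\<^sub>R axis i 1 + h n *\<^sub>R axis j 1" for n
    by (simp add: algebra_simps)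
  have eq: "partials [j, i] f (x + s n *\<^sub>R axis i 1 + t n *\<^sub>R axis j 1)
     = partials [i, j] f (x + s' n *\<^sub>R axis j 1 + t' n *\<^sub>R axis i 1)" for n
  proof -
    have "h n * (h n * partials [j, i] f (x + s n *\<^sub>R axis i 1 + t n *\<^sub>R axis j 1))
      = f (x + h n *\<^sub>R axis i 1 + h n *\<^sub>R axis j 1) - f (x + h n *\<^sub>R axis i 1) - f (x + h n *\<^sub>R axis j 1) + f x"
      using st[of n] by (elim conjE) (rule sym)
    also have "\<dots> = f (x + h n *\<^sub>R axis j 1 + h n *\<^sub>R axis i 1) - f (x + h n *\<^sub>R axis j 1) - f (x + h n *\<^sub>R axis i 1) + f x"
      by (simp add: c)
    also have "\<dots> = h n * (h n * partials [i, j] f (x + s' n *\<^sub>R axis j 1 + t' n *\<^sub>R axis i 1))"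
      using st'[of n] by (elim conjE)
    finally have "h n * (h n * partials [j, i] f (x + s n *\<^sub>R axis i 1 + t n *\<^sub>R axis j 1))
      = h n * (h n * partials [i, j] f (x + s' n *\<^sub>R axis j 1 + t' n *\<^sub>R axis i 1))" .
    then show ?thesis using h[of n] by simp
  qed
  have lim0: "u \<longlonglongrightarrow> 0" if "\<And>n. 0 < u n \<and> u n < h n" for u :: "nat \<Rightarrow> real"
    by (rule tendsto_sandwich[OF _ _ tendsto_const h0]) (use that in \<open>auto intro!: always_eventually less_imp_le\<close>)
  have tends: "(\<lambda>n. x + u n *\<^sub>R axis k 1 + v n *\<^sub>R axis l 1) \<longlonglongrightarrow> x"
    if "\<And>n. 0 < u n \<and> u n < h n" "\<And>n. 0 < v n \<and> v n < h n" for u v k l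
  proof -
    have "(\<lambda>n. x + u n *\<^sub>R axis k 1 + v n *\<^sub>R axis l 1) \<longlonglongrightarrow> x + 0 *\<^sub>R axis k 1 + 0 *\<^sub>R axis l 1"
      by (intro tendsto_intros lim0 that)
    then show ?thesis by simp
  qed
  have cont: "isCont (partials \<alpha> f) x" for \<alpha>
    using smooth_continuous_on[OF f, of UNIV \<alpha>] by (simp add: continuous_on_eq_continuous_at)
  have "(\<lambda>n. partials [j, i] f (x + s n *\<^sub>R axis i 1 + t n *\<^sub>R axis j 1)) \<longlonglongrightarrow> partials [j, i] f x"
    by (rule isCont_tendsto_compose[OF cont tends]) (use st in auto)
  moreover have "(\<lambda>n. partials [i, j] f (x + s' n *\<^sub>R axis j 1 + t' n *\<^sub>R axis i 1)) \<longlonglongrightarrow> partials [i, j] f x"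
    by (rule isCont_tendsto_compose[OF cont tends]) (use st' in auto)
  ultimately show "partials [i, j] f x = partials [j, i] f x"
    unfolding eq by (rule LIMSEQ_unique[rotated])
qed

section \<open>Integration by parts\<close>

lemma lborel_integral_translate:
  fixes f :: "'a::euclidean_space \<Rightarrow> real"
  assumes "f \<in> borel_measurable borel"
  shows "(\<integral>x. f (x + c) \<partial>lborel) = (\<integral>x. f x \<partial>lborel)"
proof -
  have "(\<integral>x. f x \<partial>lborel) = (\<integral>x. f x \<partial>distr lborel borel ((+) c))"
    by (simp add: lborel_distr_plus)
  also have "\<dots> = (\<integral>x. f (c + x) \<partial>lborel)"
    using assms by (subst integral_distr) auto
  finally show ?thesis by (simp add: add.commute)
qed

text \<open>The integral of each difference quotient vanishes by translation invariance.\<close>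

lemma integral_partial_eq_0:
  fixes f :: "real^'n::finite \<Rightarrow> real"
  assumes d: "f differentiable_on UNIV" and c: "continuous_on UNIV (partial i f)"
    and K: "compact K" and z: "\<And>x. x \<notin> K \<Longrightarrow> f x = 0"
  shows "(\<integral>x. partial i f x \<partial>lborel) = 0"
proof -
  define h :: "nat \<Rightarrow> real" where "h n = inverse (real (Suc n))" for n
  have h: "h n > 0" "h n \<le> 1" for n by (auto simp: h_def field_simps)
  have h0: "h \<longlonglongrightarrow> 0" unfolding h_def by (rule LIMSEQ_inverse_real_of_nat)
  define q where "q n x = (f (x + h n *\<^sub>R axis i 1) - f x) / h n" for n x
  have df: "f differentiable (at x)" for x using d by (auto simp: differentiable_on_def)
  have cf: "continuous_on UNIV f" using d differentiable_imp_continuous_on by blast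
  have mf [measurable]: "f \<in> borel_measurable borel" "partial i f \<in> borel_measurable borel"
    using cf c by (auto intro: borel_measurable_continuous_onI)
  have mq [measurable]: "q n \<in> borel_measurable borel" for n unfolding q_def by measurable
  obtain B where B: "\<And>x. x \<in> K \<Longrightarrow> norm x \<le> B"
    using compact_imp_bounded[OF K] by (auto simp: bounded_iff)
  have z': "f x = 0" if "norm x > B" for x using that B z by force
  \<comment> \<open>Steps have length at most 1, so every quotient \<open>q n\<close> vanishes
    outside radius \<open>B+1\<close>; the intermediate point of the mean value theorem may lie up
    to 1 further out, hence radius \<open>B+2\<close>.\<close>
  obtain M where M: "\<And>x. x \<in> cball 0 (B+2) \<Longrightarrow> \<bar>partial i f x\<bar> \<le> M"
  proof -
    have "bounded (partial i f ` cball 0 (B+2))"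
      by (intro compact_imp_bounded compact_continuous_image continuous_on_subset[OF c]) auto
    then obtain M where "\<forall>y\<in>partial i f ` cball 0 (B+2). norm y \<le> M"
      unfolding bounded_iff by blast
    then show ?thesis by (intro that[of M]) simp
  qed
  have bound: "\<bar>q n x\<bar> \<le> indicator (cball 0 (B+1)) x * M" for n x
  proof (cases "norm x \<le> B + 1")
    case True
    have "\<exists>t. 0 < t \<and> t < h n \<and> f (x + h n *\<^sub>R axis i 1) - f (x + 0 *\<^sub>R axis i 1)
        = (h n - 0) * partial i f (x + t *\<^sub>R axis i 1)"
      by (rule MVT2[OF h(1)]) (intro partial_has_real_derivative df)
    then obtain t where t: "0 < t" "t < h n"
       "f (x + h n *\<^sub>R axis i 1) - f x = h n * partial i f (x + t *\<^sub>R axis i 1)" by auto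
    have "norm (x + t *\<^sub>R axis i (1::real)) \<le> norm x + \<bar>t\<bar>"
      using norm_triangle_ineq[of x "t *\<^sub>R axis i (1::real)"] by simp
    then have "x + t *\<^sub>R axis i 1 \<in> cball 0 (B+2)"
      using True t h(2)[of n] by simp
    then have "\<bar>partial i f (x + t *\<^sub>R axis i 1)\<bar> \<le> M" by (rule M)
    then show ?thesis using t True h(1)[of n] by (simp add: q_def)
  next
    case False
    have "norm (x + h n *\<^sub>R axis i (1::real)) \<ge> norm x - \<bar>h n\<bar>"
      using norm_triangle_ineq2[of x "- (h n *\<^sub>R axis i (1::real))"] by simp
    then have "f (x + h n *\<^sub>R axis i 1) = 0" "f x = 0"
      using False h[of n] by (auto intro!: z')
    then show ?thesis using False by (simp add: q_def)
  qed
  have "(\<lambda>n. \<integral>x. q n x \<partial>lborel) \<longlonglongrightarrow> (\<integral>x. partial i f x \<partial>lborel)"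
  proof (rule integral_dominated_convergence)
    show "integrable lborel (\<lambda>x::real^'n. indicator (cball 0 (B+1)) x * M)"
      by (intro integrable_mult_left integrable_real_indicator emeasure_bounded_finite) auto
    show "AE x in lborel. (\<lambda>n. q n x) \<longlonglongrightarrow> partial i f x"
    proof (rule AE_I2)
      fix x
      have "((\<lambda>t. f (x + t *\<^sub>R axis i 1)) has_real_derivative partial i f (x + 0 *\<^sub>R axis i 1)) (at 0)"
        by (intro partial_has_real_derivative df)
      then have "((\<lambda>t. (f (x + t *\<^sub>R axis i 1) - f x) / t) \<longlongrightarrow> partial i f x) (at 0)"
        by (simp add: DERIV_def)
      moreover have "filterlim h (at 0) sequentially"
        using h0 h(1) by (simp add: filterlim_at less_imp_neq[symmetric])
      ultimately show "(\<lambda>n. q n x) \<longlonglongrightarrow> partial i f x"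
        unfolding q_def by (rule filterlim_compose)
    qed
  qed (use bound in simp_all)
  moreover have "(\<integral>x. q n x \<partial>lborel) = 0" for n
  proof -
    have int: "integrable lborel f"
    proof -
      have "integrable lborel (\<lambda>x. indicator (cball 0 (B+1)) x *\<^sub>R f x)"
        by (rule borel_integrable_compact) (auto intro: continuous_on_subset[OF cf])
      moreover have "(\<lambda>x. indicator (cball 0 (B+1)) x *\<^sub>R f x) = f"
        by (auto simp: fun_eq_iff indicator_def z')
      ultimately show ?thesis by simp
    qed
    have int': "integrable lborel (\<lambda>x. f (x + h n *\<^sub>R axis i 1))"
    proof -
      have "integrable (distr lborel borel ((+) (h n *\<^sub>R axis i 1))) f"
        using int by (simp add: lborel_distr_plus)
      then show ?thesis by (subst (asm) integrable_distr_eq) (auto simp: add.commute)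
    qed
    show ?thesis
      unfolding q_def using int int' by (simp add: lborel_integral_translate)
  qed
  ultimately show ?thesis by (simp add: LIMSEQ_const_iff)
qed

text \<open>Weak derivatives are tested against the completed measure restricted to \<Omega>,
  whereas translation invariance was used for \<open>lborel\<close>; this passes between the
  two.\<close>

lemma integral_lebesgue_on_eq_lborel:
  fixes f :: "'a::euclidean_space \<Rightarrow> real"
  assumes "\<Omega> \<in> sets lebesgue" "f \<in> borel_measurable borel" "\<And>x. x \<notin> \<Omega> \<Longrightarrow> f x = 0"
  shows "(\<integral>x. f x \<partial>lebesgue_on \<Omega>) = (\<integral>x. f x \<partial>lborel)"
proof -
  have "(\<lambda>x. if x \<in> \<Omega> then f x else 0) = f" using assms(3) by auto
  then show ?thesis
    using Lebesgue_Measure.integral_restrict_UNIV[OF assms(1), of f] assms(2) by (simp add: integral_completion)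
qed

lemma integrable_lborel_compact_support:
  fixes f :: "'a::euclidean_space \<Rightarrow> real"
  assumes "continuous_on UNIV f" "compact K" "\<And>x. x \<notin> K \<Longrightarrow> f x = 0"
  shows "integrable lborel f"
proof -
  have "(\<lambda>x. indicator K x *\<^sub>R f x) = f" using assms(3) by (auto simp: fun_eq_iff indicator_def)
  then show ?thesis
    using borel_integrable_compact[OF assms(2) continuous_on_subset[OF assms(1)]] by simp
qed

lemma integrable_lebesgue_on_compact:
  fixes f :: "'a::euclidean_space \<Rightarrow> real"
  assumes "continuous_on UNIV f" "compact K"
  shows "integrable (lebesgue_on K) f"
proof -
  have "integrable lborel (\<lambda>x. indicator K x *\<^sub>R f x)"
    by (intro borel_integrable_compact continuous_on_subset[OF assms(1)] assms(2)) auto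
  moreover have "(\<lambda>x. indicator K x *\<^sub>R f x) \<in> borel_measurable borel"
    using assms by (intro borel_measurable_scaleR borel_measurable_indicator borel_measurable_continuous_onI)
      (auto simp: borel_compact)
  ultimately have "integrable lebesgue (\<lambda>x. indicator K x *\<^sub>R f x)"
    by (simp add: integrable_completion)
  then show ?thesis
    using assms(2) by (subst integrable_restrict_space) (auto simp: borel_compact)
qed

lemma locally_integrable_on_continuous:
  "continuous_on UNIV f \<Longrightarrow> locally_integrable_on f \<Omega>"
  by (auto simp: locally_integrable_on_def integrable_lebesgue_on_compact)

text \<open>Differentiation cannot enlarge the support, so derivatives can be moved off a test
  function one at a time.\<close>

lemma test_functions_partials:
  assumes "\<phi> \<in> test_functions \<Omega>"
  shows "partials \<alpha> \<phi> \<in> test_functions \<Omega>"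
proof -
  have "closure {x. partials \<alpha> \<phi> x \<noteq> 0} \<subseteq> closure {x. \<phi> x \<noteq> 0}"
    using partials_eq_0_outside_support[of _ \<phi> \<alpha>] by (intro closure_minimal) auto
  moreover from this have "compact (closure {x. partials \<alpha> \<phi> x \<noteq> 0})"
    using assms unfolding test_functions_def
    by (metis (mono_tags, lifting) closed_closure compact_Int_closed inf.absorb_iff2 mem_Collect_eq)
  ultimately show ?thesis
    using assms smooth_partials unfolding test_functions_def by blast
qed

lemma test_function_support:
  assumes "\<phi> \<in> test_functions \<Omega>"
  obtains K where "compact K" "K \<subseteq> \<Omega>" "\<And>x. x \<notin> K \<Longrightarrow> \<phi> x = 0"
  using assms closure_subset[of "{x. \<phi> x \<noteq> 0}"] unfolding test_functions_def by blast

text \<open>The product \<open>f * \<phi>\<close> inherits the compact support of \<phi>, so the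
  integral of its partial derivative vanishes and no boundary term appears; the product rule does
  the rest.\<close>

lemma integral_by_parts:
  fixes f \<phi> :: "real^'n::finite \<Rightarrow> real"
  assumes f: "smooth f" and \<phi>: "\<phi> \<in> test_functions \<Omega>" and \<Omega>: "open \<Omega>"
  shows "(\<integral>x. f x * partial i \<phi> x \<partial>lebesgue_on \<Omega>) = - (\<integral>x. partial i f x * \<phi> x \<partial>lebesgue_on \<Omega>)"
proof -
  let ?K = "closure {x. \<phi> x \<noteq> 0}"
  have s\<phi>: "smooth \<phi>" and K: "compact ?K" "?K \<subseteq> \<Omega>" using \<phi> by (auto simp: test_functions_def)
  have d: "f differentiable (at x)" "\<phi> differentiable (at x)" for x
    using smooth_differentiable[OF f, of "[]"] smooth_differentiable[OF s\<phi>, of "[]"] by auto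
  have c: "continuous_on UNIV f" "continuous_on UNIV \<phi>" "continuous_on UNIV (partial i f)" "continuous_on UNIV (partial i \<phi>)"
    using smooth_continuous_on[OF f, of _ "[]"] smooth_continuous_on[OF s\<phi>, of _ "[]"]
      smooth_continuous_on[OF f, of _ "[i]"] smooth_continuous_on[OF s\<phi>, of _ "[i]"] by auto
  have z1: "f x * \<phi> x = 0" and z2: "f x * partial i \<phi> x = 0" and z3: "partial i f x * \<phi> x = 0"
    if "x \<notin> ?K" for x
    using partials_eq_0_outside_support[OF that, of "[]"] partials_eq_0_outside_support[OF that, of "[i]"] by auto
  have eq: "partial i (\<lambda>x. f x * \<phi> x) = (\<lambda>x. f x * partial i \<phi> x + partial i f x * \<phi> x)"
    using d by (simp add: fun_eq_iff partial_mult)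
  have c1: "continuous_on UNIV (\<lambda>x. f x * partial i \<phi> x)" and c2: "continuous_on UNIV (\<lambda>x. partial i f x * \<phi> x)"
    using c by (auto intro: continuous_on_mult)
  have "(\<integral>x. partial i (\<lambda>x. f x * \<phi> x) x \<partial>lborel) = 0"
  proof (rule integral_partial_eq_0[OF _ _ K(1)])
    show "(\<lambda>x. f x * \<phi> x) differentiable_on UNIV"
      using d by (auto simp: differentiable_on_def)
    show "continuous_on UNIV (partial i (\<lambda>x. f x * \<phi> x))"
      unfolding eq by (intro continuous_on_add c1 c2)
  qed (rule z1)
  moreover have "integrable lborel (\<lambda>x. f x * partial i \<phi> x)" "integrable lborel (\<lambda>x. partial i f x * \<phi> x)"
    by (rule integrable_lborel_compact_support[OF c1 K(1) z2], assumption,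
        rule integrable_lborel_compact_support[OF c2 K(1) z3])
  ultimately have "(\<integral>x. f x * partial i \<phi> x \<partial>lborel) = - (\<integral>x. partial i f x * \<phi> x \<partial>lborel)"
    by (simp add: eq)
  moreover have "(\<integral>x. g x \<partial>lebesgue_on \<Omega>) = (\<integral>x. g x \<partial>lborel)"
    if "continuous_on UNIV g" "\<And>x. x \<notin> ?K \<Longrightarrow> g x = 0" for g :: "real^'n \<Rightarrow> real"
  proof (rule integral_lebesgue_on_eq_lborel)
    show "\<Omega> \<in> sets lebesgue" using \<Omega> by simp
    show "g \<in> borel_measurable borel" using that(1) by (rule borel_measurable_continuous_onI)
    show "g x = 0" if "x \<notin> \<Omega>" for x using K(2) that \<open>\<And>x. x \<notin> ?K \<Longrightarrow> g x = 0\<close> by blast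
  qed
  ultimately show ?thesis by (metis (lifting) c1 c2 z2 z3)
qed

text \<open>The outermost derivative on \<phi> is the first to be moved and so becomes the innermost
  one on \<open>f\<close>; hence the reversed list.\<close>

lemma smooth_has_weak_deriv:
  fixes f :: "real^'n::finite \<Rightarrow> real"
  assumes f: "smooth f" and \<Omega>: "open \<Omega>"
  shows "has_weak_deriv \<Omega> \<alpha> f (partials (rev \<alpha>) f)"
proof -
  have "(\<integral>x. f x * partials \<alpha> \<phi> x \<partial>lebesgue_on \<Omega>)
      = (-1) ^ length \<alpha> * (\<integral>x. partials (rev \<alpha>) f x * \<phi> x \<partial>lebesgue_on \<Omega>)"
    if "\<phi> \<in> test_functions \<Omega>" for \<phi>
    using f
  proof (induction \<alpha> arbitrary: f)
    case Nil
    then show ?case by simp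
  next
    case (Cons i \<alpha>)
    have "(\<integral>x. f x * partial i (partials \<alpha> \<phi>) x \<partial>lebesgue_on \<Omega>)
        = - (\<integral>x. partial i f x * partials \<alpha> \<phi> x \<partial>lebesgue_on \<Omega>)"
      by (intro integral_by_parts Cons.prems test_functions_partials that \<Omega>)
    then show ?case
      using Cons.IH[OF smooth_partials[OF Cons.prems, of "[i]"]] by (simp add: partials_append)
  qed
  moreover have "locally_integrable_on f \<Omega>" "locally_integrable_on (partials (rev \<alpha>) f) \<Omega>"
    using smooth_continuous_on[OF f, of _ "[]"] smooth_continuous_on[OF f]
    by (auto intro: locally_integrable_on_continuous)
  ultimately show ?thesis unfolding has_weak_deriv_def by blast
qed

section \<open>Bump functions\<close>

definition flat :: "real poly \<Rightarrow> real \<Rightarrow> real" where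
  "flat p t = (if t > 0 then poly p (1 / t) * exp (- (1 / t)) else 0)"

lemma tendsto_poly_times_exp_neg: "((\<lambda>x. poly p x * exp (- x)) \<longlongrightarrow> (0::real)) at_top"
proof -
  have "((\<lambda>x. \<Sum>i\<le>degree p. coeff p i * (x ^ i / exp x)) \<longlongrightarrow> (\<Sum>i\<le>degree p. coeff p i * 0)) at_top"
    by (intro tendsto_intros tendsto_power_div_exp_0)
  then show ?thesis
    by (simp add: poly_altdef sum_distrib_right exp_minus divide_inverse mult.assoc)
qed

text \<open>With \<open>s = 1/t\<close> one has \<open>ds/dt = -s^2\<close>, so
  \<open>p(s) * exp(-s)\<close> has derivative \<open>s^2 * (p(s) - p'(s)) * exp(-s)\<close>; the
  polynomial \<open>[:0, 0, 1:]\<close> is the factor \<open>s^2\<close>. Only \<open>t = 0\<close>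
  needs a limit.\<close>

lemma flat_has_real_derivative:
  "(flat p has_real_derivative flat ([:0, 0, 1:] * (p - pderiv p)) t) (at t)"
proof -
  consider "t > 0" | "t < 0" | "t = 0" by linarith
  then show ?thesis
  proof cases
    case 1
    show ?thesis
    proof (rule has_field_derivative_transform_within_open)
      show "((\<lambda>t. poly p (1 / t) * exp (- (1 / t))) has_real_derivative flat ([:0, 0, 1:] * (p - pderiv p)) t) (at t)"
        using 1 by (auto intro!: derivative_eq_intros DERIV_chain2[OF poly_DERIV]
            simp: flat_def field_simps power2_eq_square)
      show "open {0::real<..}" by simp
    qed (use 1 in \<open>auto simp: flat_def\<close>)
  next
    case 2
    show ?thesis
    proof (rule has_field_derivative_transform_within_open)
      show "((\<lambda>t. 0) has_real_derivative flat ([:0, 0, 1:] * (p - pderiv p)) t) (at t)"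
        using 2 by (simp add: flat_def)
      show "open {..<(0::real)}" by simp
    qed (use 2 in \<open>auto simp: flat_def\<close>)
  next
    case 3
    have "((\<lambda>h. flat p h / h) \<longlongrightarrow> 0) (at_right 0)"
    proof (rule Lim_transform_eventually)
      \<comment> \<open>The division by \<open>h\<close> in the difference quotient is one more
        factor \<open>1/h\<close>, absorbed into the polynomial by \<open>pCons 0 p\<close>; the
        exponential then dominates.\<close>
      show "((\<lambda>h::real. poly (pCons 0 p) (inverse h) * exp (- inverse h)) \<longlongrightarrow> 0) (at_right 0)"
        by (rule filterlim_compose[OF tendsto_poly_times_exp_neg filterlim_inverse_at_top_right])
      show "\<forall>\<^sub>F h in at_right 0. poly (pCons 0 p) (inverse h) * exp (- inverse h) = flat p h / h"
        by (auto simp: eventually_at_right_less flat_def divide_inverse mult_ac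
            intro: eventually_mono[OF eventually_at_right_less])
    qed
    moreover have "((\<lambda>h. flat p h / h) \<longlongrightarrow> 0) (at_left 0)"
    proof (rule Lim_transform_eventually)
      show "\<forall>\<^sub>F h in at_left 0. 0 = flat p h / h"
        by (rule eventually_at_leftI[of "-1"]) (auto simp: flat_def)
    qed simp
    ultimately have "((\<lambda>h. flat p h / h) \<longlongrightarrow> 0) (at 0)"
      by (rule filterlim_split_at[rotated])
    then show ?thesis
      using 3 by (simp add: DERIV_def flat_def)
  qed
qed

lemma flat_1_bounds: "0 \<le> flat 1 t" "flat 1 t \<le> 1" "flat 1 t \<noteq> 0 \<longleftrightarrow> t > 0"
  by (auto simp: flat_def)

lemma tendsto_flat_1: "s > 0 \<Longrightarrow> (\<lambda>n. flat 1 (real n * s)) \<longlonglongrightarrow> 1"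
proof (rule Lim_transform_eventually)
  assume s: "s > 0"
  have "(\<lambda>n. exp (- (inverse s * inverse (real n)))) \<longlonglongrightarrow> exp (- (inverse s * 0))"
    by (intro tendsto_intros lim_inverse_n)
  then show "(\<lambda>n. exp (- (inverse s * inverse (real n)))) \<longlonglongrightarrow> 1" by simp
  \<comment> \<open>The two sides differ at \<open>n = 0\<close>: there \<open>inverse 0 = 0\<close>
    makes the left side 1, while \<open>flat 1 0 = 0\<close>.\<close>
  show "\<forall>\<^sub>F n in sequentially. exp (- (inverse s * inverse (real n))) = flat 1 (real n * s)"
    using s by (intro eventually_mono[OF eventually_gt_at_top[of 0]]) (simp add: flat_def field_simps)
qed

text \<open>An algebra of functions closed under partial derivatives; hence its members are smooth.\<close>

inductive_set flat_algebra :: "(real^'n::finite \<Rightarrow> real) set" where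
  const: "(\<lambda>x. c) \<in> flat_algebra"
| coord: "(\<lambda>x. x $ i) \<in> flat_algebra"
| flat: "(\<lambda>x. flat p (c * x $ i + d)) \<in> flat_algebra"
| add: "f \<in> flat_algebra \<Longrightarrow> g \<in> flat_algebra \<Longrightarrow> (\<lambda>x. f x + g x) \<in> flat_algebra"
| mult: "f \<in> flat_algebra \<Longrightarrow> g \<in> flat_algebra \<Longrightarrow> (\<lambda>x. f x * g x) \<in> flat_algebra"

text \<open>Differentiability and closure are proved together because the product rule for
  \<open>partial\<close> needs both factors differentiable. For the generator \<open>flat\<close>,
  the derivative is another \<open>flat\<close> times the slope of the affine argument.\<close>

lemma flat_algebra_partial:
  fixes f :: "real^'n::finite \<Rightarrow> real"
  assumes "f \<in> flat_algebra"
  shows "(\<forall>x. f differentiable (at x)) \<and> (\<forall>i. partial i f \<in> flat_algebra)"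
  using assms
proof induction
  case (const c)
  then show ?case by (auto simp: partial_const intro: flat_algebra.const)
next
  case (coord i)
  then show ?case
    by (auto simp: partial_coord intro!: flat_algebra.const bounded_linear_imp_differentiable bounded_linear_vec_nth)
next
  case (flat p c i d)
  let ?q = "[:0, 0, 1:] * (p - pderiv p)"
  have d: "((\<lambda>x::real^'n. flat p (c * x $ i + d)) has_derivative (\<lambda>h. flat ?q (c * x $ i + d) * (c * h $ i))) (at x)" for x
  proof -
    have a: "((\<lambda>x::real^'n. c * x $ i + d) has_derivative (\<lambda>h. c * h $ i)) (at x)"
      by (auto intro!: derivative_eq_intros bounded_linear_imp_has_derivative bounded_linear_vec_nth)
    show ?thesis
      using has_derivative_compose[OF a flat_has_real_derivative[unfolded has_field_derivative_def]] by simp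
  qed
  have "partial j (\<lambda>x::real^'n. flat p (c * x $ i + d)) = (\<lambda>x. flat ?q (c * x $ i + d) * (if i = j then c else 0))" for j
    by (rule ext, subst partial_eqI[OF d]) (simp add: axis_def)
  then show ?case
    using d by (auto simp: differentiable_def intro!: flat_algebra.mult flat_algebra.flat flat_algebra.const
        simp del: mult_pCons_left)
next
  case (add f g)
  then have "partial i (\<lambda>x. f x + g x) = (\<lambda>x. partial i f x + partial i g x)" for i
    by (simp add: fun_eq_iff partial_add)
  then show ?case using add by (auto intro: flat_algebra.add)
next
  case (mult f g)
  then have "partial i (\<lambda>x. f x * g x) = (\<lambda>x. f x * partial i g x + partial i f x * g x)" for i
    by (simp add: fun_eq_iff partial_mult)
  then show ?case using mult by (auto intro!: flat_algebra.add flat_algebra.mult)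
qed

lemma flat_algebra_smooth:
  assumes "f \<in> flat_algebra"
  shows "smooth f"
proof -
  have "partials \<alpha> f \<in> flat_algebra" for \<alpha>
    using assms by (induction \<alpha>) (auto simp: flat_algebra_partial)
  then show ?thesis
    using flat_algebra_partial unfolding smooth_def differentiable_on_def by blast
qed

lemma flat_algebra_prod:
  "finite I \<Longrightarrow> (\<And>i. i \<in> I \<Longrightarrow> f i \<in> flat_algebra) \<Longrightarrow> (\<lambda>x. \<Prod>i\<in>I. f i x) \<in> flat_algebra"
  by (induction I rule: finite_induct) (auto intro: flat_algebra.intros)

text \<open>One cutoff per face of the box. Multiplying the distance to each face by
  \<open>n\<close> steepens the cutoffs, so explicit smooth functions approach the indicator of the
  open box without any convolution.\<close>

definition bump :: "real^'n::finite \<Rightarrow> real^'n \<Rightarrow> nat \<Rightarrow> real^'n \<Rightarrow> real" where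
  "bump a b n x = (\<Prod>i\<in>UNIV. flat 1 (real n * (x $ i - a $ i)) * flat 1 (real n * (b $ i - x $ i)))"

lemma smooth_bump: "smooth (bump a b n)"
proof -
  have "(\<lambda>x. flat 1 (real n * (x $ i - a $ i)) * flat 1 (real n * (b $ i - x $ i))) \<in> flat_algebra" for i
  proof -
    have "(\<lambda>x. flat 1 (real n * x $ i + - real n * a $ i) * flat 1 (- real n * x $ i + real n * b $ i)) \<in> flat_algebra"
      by (intro flat_algebra.intros)
    then show ?thesis by (simp add: algebra_simps)
  qed
  then show ?thesis
    unfolding bump_def by (intro flat_algebra_smooth flat_algebra_prod) auto
qed

lemma bump_nonzero: "bump a b n x \<noteq> 0 \<Longrightarrow> x \<in> box a b"
  by (auto simp: bump_def mem_box_cart flat_1_bounds zero_less_mult_iff)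

lemma bump_bounds: "0 \<le> bump a b n x" "bump a b n x \<le> 1"
  unfolding bump_def by (auto intro!: prod_nonneg prod_le_1 mult_le_one simp: flat_1_bounds)

lemma tendsto_bump: "(\<lambda>n. bump a b n x) \<longlonglongrightarrow> indicator (box a b) x"
proof (cases "x \<in> box a b")
  case True
  have "(\<lambda>n. bump a b n x) \<longlonglongrightarrow> (\<Prod>i\<in>(UNIV::'a set). 1 * 1)"
    unfolding bump_def using True by (intro tendsto_prod tendsto_mult tendsto_flat_1) (auto simp: mem_box_cart)
  then show ?thesis using True by simp
next
  case False
  then have "bump a b n x = 0" for n using bump_nonzero by blast
  then show ?thesis using False by simp
qed

lemma bump_test_function:
  assumes "cbox a b \<subseteq> \<Omega>"
  shows "bump a b n \<in> test_functions \<Omega>"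
proof -
  have "closure {x. bump a b n x \<noteq> 0} \<subseteq> cbox a b"
    using bump_nonzero box_subset_cbox by (intro closure_minimal) blast+
  moreover from this have "compact (closure {x. bump a b n x \<noteq> 0})"
    by (metis closed_closure compact_cbox compact_Int_closed inf.absorb_iff2)
  ultimately show ?thesis
    using assms smooth_bump unfolding test_functions_def by blast
qed

section \<open>Uniqueness of weak derivatives\<close>

text \<open>Local integrability controls \<open>h\<close> only on compact sets; the support of
  \<phi> is one, \<phi> is bounded there, and the product is 0 elsewhere. Integrals against a
  difference of weak derivatives can thus be split.\<close>

lemma locally_integrable_times_test_function:
  fixes h :: "real^'n::finite \<Rightarrow> real"
  assumes h: "locally_integrable_on h \<Omega>" and \<phi>: "\<phi> \<in> test_functions \<Omega>" and \<Omega>: "open \<Omega>"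
  shows "integrable (lebesgue_on \<Omega>) (\<lambda>x. h x * \<phi> x)"
proof -
  obtain K where K: "compact K" "K \<subseteq> \<Omega>" and z: "\<And>x. x \<notin> K \<Longrightarrow> \<phi> x = 0"
    using test_function_support[OF \<phi>] by blast
  have s\<phi>: "smooth \<phi>" using \<phi> by (simp add: test_functions_def)
  have sK: "K \<in> sets lebesgue" using K(1) by (simp add: compact_imp_closed)
  have c: "continuous_on UNIV \<phi>" using smooth_continuous_on[OF s\<phi>, of _ "[]"] by simp
  have "bounded (\<phi> ` K)"
    by (intro compact_imp_bounded compact_continuous_image continuous_on_subset[OF c] K) auto
  then obtain M where M: "\<And>x. x \<in> K \<Longrightarrow> \<bar>\<phi> x\<bar> \<le> M" unfolding bounded_iff by (metis imageI real_norm_def)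
  have hK: "integrable (lebesgue_on K) h" using h K by (auto simp: locally_integrable_on_def)
  have "integrable (lebesgue_on K) (\<lambda>x. h x * \<phi> x)"
  proof (rule Bochner_Integration.integrable_bound)
    show "integrable (lebesgue_on K) (\<lambda>x. M * h x)" using hK by simp
    show "(\<lambda>x. h x * \<phi> x) \<in> borel_measurable (lebesgue_on K)"
      by (intro borel_measurable_times borel_measurable_integrable[OF hK]
          continuous_imp_measurable_on_sets_lebesgue continuous_on_subset[OF c] sK) auto
    show "AE x in lebesgue_on K. norm (h x * \<phi> x) \<le> norm (M * h x)"
    proof (rule AE_I2)
      fix x assume "x \<in> space (lebesgue_on K)"
      then have "\<bar>\<phi> x\<bar> \<le> \<bar>M\<bar>" using M by fastforce
      then show "norm (h x * \<phi> x) \<le> norm (M * h x)"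
        by (simp add: abs_mult mult.commute mult_right_mono)
    qed
  qed
  moreover have "(\<lambda>x. if x \<in> K then h x * \<phi> x else 0) = (\<lambda>x. if x \<in> \<Omega> then h x * \<phi> x else 0)"
    using K z by (auto simp: fun_eq_iff)
  ultimately show ?thesis
    using \<Omega> sK Lebesgue_Measure.integrable_restrict_UNIV[of K "\<lambda>x. h x * \<phi> x"]
      Lebesgue_Measure.integrable_restrict_UNIV[of \<Omega> "\<lambda>x. h x * \<phi> x"]
    by simp
qed

text \<open>Dominated convergence along the bumps. Since they take values in \<open>[0, 1]\<close>
  and live in the box, the majorant is \<open>\<bar>h\<bar>\<close> on the closed box, which is
  integrable because that box is a compact subset of \<Omega>.\<close>

lemma integral_box_eq_0:
  fixes h :: "real^'n::finite \<Rightarrow> real"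
  assumes h: "locally_integrable_on h \<Omega>" and \<Omega>: "open \<Omega>"
    and z: "\<And>\<phi>. \<phi> \<in> test_functions \<Omega> \<Longrightarrow> (\<integral>x. h x * \<phi> x \<partial>lebesgue_on \<Omega>) = 0"
    and ab: "cbox a b \<subseteq> \<Omega>"
  shows "(\<integral>x. indicator (box a b) x * h x \<partial>lebesgue) = 0"
proof -
  have hc: "integrable (lebesgue_on (cbox a b)) h" using h ab by (auto simp: locally_integrable_on_def)
  have sO: "\<Omega> \<in> sets lebesgue" using \<Omega> by auto
  have bsub: "box a b \<subseteq> cbox a b" by (rule box_subset_cbox)
  have "(\<lambda>n. \<integral>x. indicator (cbox a b) x * h x * bump a b n x \<partial>lebesgue)
     \<longlonglongrightarrow> (\<integral>x. indicator (cbox a b) x * h x * indicator (box a b) x \<partial>lebesgue)"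
  proof (rule integral_dominated_convergence)
    have bound: "norm (y * bump a b n x) \<le> \<bar>y\<bar>" for y n x
      using bump_bounds[of a b n x] by (simp add: abs_mult mult_left_le)
    have i: "integrable lebesgue (\<lambda>x. indicator (cbox a b) x * h x)"
      using hc by (simp add: integrable_restrict_space)
    then show "integrable lebesgue (\<lambda>x. \<bar>indicator (cbox a b) x * h x\<bar>)" by (rule integrable_abs)
    have m: "(\<lambda>x. indicator (cbox a b) x * h x) \<in> borel_measurable lebesgue" using i by auto
    have mb: "bump a b n \<in> borel_measurable lebesgue" for n
      using smooth_continuous_on[OF smooth_bump, of UNIV "[]" a b n]
      by (intro measurable_completion) (auto intro: borel_measurable_continuous_onI)
    show "(\<lambda>x. indicator (cbox a b) x * h x * indicator (box a b) x) \<in> borel_measurable lebesgue"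
      by (rule borel_measurable_times[OF m borel_measurable_indicator]) simp
    show "(\<lambda>x. indicator (cbox a b) x * h x * bump a b n x) \<in> borel_measurable lebesgue" for n
      by (rule borel_measurable_times[OF m mb])
    show "AE x in lebesgue. (\<lambda>n. indicator (cbox a b) x * h x * bump a b n x)
        \<longlonglongrightarrow> indicator (cbox a b) x * h x * indicator (box a b) x"
      by (intro AE_I2 tendsto_mult tendsto_const tendsto_bump)
    show "AE x in lebesgue. norm (indicator (cbox a b) x * h x * bump a b n x) \<le> \<bar>indicator (cbox a b) x * h x\<bar>" for n
      using bound by (intro AE_I2)
  qed
  moreover have "(\<integral>x. indicator (cbox a b) x * h x * bump a b n x \<partial>lebesgue) = 0" for n
  proof -
    have "(\<integral>x. h x * bump a b n x \<partial>lebesgue_on \<Omega>)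
        = (\<integral>x. indicator \<Omega> x *\<^sub>R (h x * bump a b n x) \<partial>lebesgue)"
      using sO by (intro integral_restrict_space) simp
    also have "(\<lambda>x. indicator \<Omega> x *\<^sub>R (h x * bump a b n x)) = (\<lambda>x. indicator (cbox a b) x * h x * bump a b n x)"
      using bump_nonzero[of a b n] ab bsub by (auto simp: indicator_def fun_eq_iff)
    finally show ?thesis using z[OF bump_test_function[OF ab]] by simp
  qed
  moreover have "indicator (cbox a b) x * h x * indicator (box a b) x = indicator (box a b) x * h x" for x
    using bsub by (auto simp: indicator_def)
  ultimately show ?thesis by (simp add: LIMSEQ_const_iff)
qed

text \<open>Open boxes form an intersection-stable generator of the Borel sets, so a Dynkin argument
  extends the vanishing to every Borel set; the vanishing total integral handles complements. Two
  densities with equal integrals over all Borel sets agree almost everywhere.\<close>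

lemma AE_zero_if_integral_boxes_zero:
  fixes f :: "'a::euclidean_space \<Rightarrow> real"
  assumes f: "integrable lborel f"
    and box: "\<And>a b. (\<integral>x. indicator (box a b) x * f x \<partial>lborel) = 0"
    and UNIV: "(\<integral>x. f x \<partial>lborel) = 0"
  shows "AE x in lborel. f x = 0"
proof (rule density_unique_real[OF f])
  show "integrable lborel (\<lambda>x::'a. 0::real)" by simp
  fix A :: "'a set" assume "A \<in> sets lborel"
  then have A: "A \<in> sigma_sets UNIV (range (\<lambda>(a, b). box a b))"
    by (simp add: borel_eq_box)
  have si: "set_integrable lborel B f" if "B \<in> sets borel" for B
    using integrable_mult_indicator[OF _ f, of B] that by (simp add: set_integrable_def)
  have sets: "sigma_sets UNIV (range (\<lambda>(a, b). box a b)) = sets (borel :: 'a measure)"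
    by (simp add: borel_eq_box)
  have "Int_stable (range (\<lambda>(a, b). box a b :: 'a set))"
    by (auto simp: Int_stable_def box_Int_box)
  moreover have "range (\<lambda>(a, b). box a b) \<subseteq> Pow (UNIV :: 'a set)" by simp
  ultimately have "(LINT x:A|lborel. f x) = 0"
    using A
  proof (induction rule: sigma_sets_induct_disjoint)
    case (basic B)
    then show ?case using box by (auto simp: set_lebesgue_integral_def)
  next
    case empty
    then show ?case by (simp add: set_lebesgue_integral_def)
  next
    case (compl B)
    then have B: "B \<in> sets borel" using sets by simp
    have "(LINT x:UNIV - B|lborel. f x) + (LINT x:B|lborel. f x) = (LINT x:(UNIV - B) \<union> B|lborel. f x)"
      using B by (intro set_integral_Un[symmetric] si) auto
    then show ?case using compl UNIV by (simp add: set_lebesgue_integral_def)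
  next
    case (union B)
    have B: "B i \<in> sets borel" for i using union sets by auto
    have "(LINT x:(\<Union>i. B i)|lborel. f x) = (\<Sum>i. (LINT x:B i|lborel. f x))"
      using union(1) B by (intro lebesgue_integral_countable_add si) (auto simp: disjoint_family_on_def)
    then show ?case using union by simp
  qed
  then show "(LINT x:A|lborel. f x) = (LINT x:A|lborel. 0)" by (simp add: set_lebesgue_integral_def)
qed

lemma AE_zero_on_cbox:
  fixes h :: "real^'n::finite \<Rightarrow> real"
  assumes h: "locally_integrable_on h \<Omega>" and \<Omega>: "open \<Omega>"
    and z: "\<And>\<phi>. \<phi> \<in> test_functions \<Omega> \<Longrightarrow> (\<integral>x. h x * \<phi> x \<partial>lebesgue_on \<Omega>) = 0"
    and ab: "cbox a b \<subseteq> \<Omega>"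
  shows "AE x in lebesgue. x \<in> cbox a b \<longrightarrow> h x = 0"
proof -
  have "integrable (lebesgue_on (cbox a b)) h" using h ab by (auto simp: locally_integrable_on_def)
  then have hc: "integrable lebesgue (\<lambda>x. indicator (cbox a b) x * h x)"
    by (simp add: integrable_restrict_space)
  have "integrable lebesgue (\<lambda>x. indicator (box a b) x *\<^sub>R (indicator (cbox a b) x * h x))"
    by (intro integrable_mult_indicator hc) auto
  moreover have "(\<lambda>x. indicator (box a b) x *\<^sub>R (indicator (cbox a b) x * h x)) = (\<lambda>x. indicator (box a b) x * h x)"
    using box_subset_cbox[of a b] by (auto simp: indicator_def fun_eq_iff)
  ultimately have hb: "integrable lebesgue (\<lambda>x. indicator (box a b) x * h x)" by metis
  \<comment> \<open>The Dynkin argument runs over \<open>lborel\<close>, but \<open>h\<close> is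
    only Lebesgue measurable, so its truncation is replaced by a Borel function equal to it almost
    everywhere.\<close>
  then obtain f where f: "f \<in> borel_measurable lborel" and eq: "AE x in lborel. indicator (box a b) x * h x = f x"
    using completion_ex_borel_measurable_real[of "\<lambda>x. indicator (box a b) x * h x" lborel] by auto
  have eq': "AE x in lebesgue. indicator (box a b) x * h x = f x"
    using eq by (rule AE_completion)
  have fm: "f \<in> borel_measurable lebesgue" using f by (rule measurable_completion)
  have "integrable lebesgue f"
    using hb fm eq' by (rule integrable_cong_AE_imp) 
  then have fi: "integrable lborel f" using f by (simp add: integrable_completion)
  have int: "(\<integral>x. indicator B x * f x \<partial>lborel) = (\<integral>x. indicator (B \<inter> box a b) x * h x \<partial>lebesgue)"
    if B: "B \<in> sets borel" for B
  proof -
    have "(\<integral>x. indicator B x * f x \<partial>lborel) = (\<integral>x. indicator B x * f x \<partial>lebesgue)"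
      using f B by (intro integral_completion[symmetric]) auto
    also have "\<dots> = (\<integral>x. indicator B x * (indicator (box a b) x * h x) \<partial>lebesgue)"
    proof (rule integral_cong_AE)
      have iB: "indicator B \<in> borel_measurable lebesgue" using B by (intro borel_measurable_indicator) simp
      show "(\<lambda>x. indicator B x * f x) \<in> borel_measurable lebesgue"
        by (rule borel_measurable_times[OF iB fm])
      show "(\<lambda>x. indicator B x * (indicator (box a b) x * h x)) \<in> borel_measurable lebesgue"
        by (rule borel_measurable_times[OF iB borel_measurable_integrable[OF hb]])
      show "AE x in lebesgue. indicator B x * f x = indicator B x * (indicator (box a b) x * h x)"
        using eq' by eventually_elim simp
    qed
    also have "\<dots> = (\<integral>x. indicator (B \<inter> box a b) x * h x \<partial>lebesgue)"
      by (simp add: indicator_inter_arith mult.assoc)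
    finally show ?thesis .
  qed
  have box: "(\<integral>x. indicator (box c d) x * f x \<partial>lborel) = 0" for c d
  proof -
    \<comment> \<open>The same corners describe the open and the closed intersection. Hence the
      closed box stays inside \<Omega> for arbitrary \<open>c\<close> and \<open>d\<close>, as the
      vanishing of box integrals requires.\<close>
    obtain c' d' where cd: "box c d \<inter> box a b = box c' d'" "cbox c d \<inter> cbox a b = cbox c' d'"
      by (rule that[OF box_Int_box Int_interval])
    then have "cbox c' d' \<subseteq> \<Omega>" using ab by blast
    then show ?thesis using int[of "box c d"] integral_box_eq_0[OF h \<Omega> z] cd by simp
  qed
  have "(\<integral>x. f x \<partial>lborel) = 0"
    using int[of UNIV] integral_box_eq_0[OF h \<Omega> z ab] by simp
  from AE_completion[OF AE_zero_if_integral_boxes_zero[OF fi box this]]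
  have "AE x in lebesgue. f x = 0" .
  \<comment> \<open>The function \<open>f\<close> carries \<open>h\<close> on the open box only; the
    faces form a null set.\<close>
  moreover have "AE x in lebesgue. x \<notin> cbox a b - box a b"
    using null_sets_cbox_Diff_box[of a b] by (intro AE_completion AE_not_in)
  ultimately show ?thesis
    using eq' by eventually_elim (auto simp: indicator_def split: if_splits)
qed

text \<open>The fundamental lemma of the calculus of variations. An open set is a countable union of
  closed boxes, so the exceptional null sets of the boxes unite to a null set.\<close>

lemma AE_zero_if_orthogonal_to_test_functions:
  fixes h :: "real^'n::finite \<Rightarrow> real"
  assumes h: "locally_integrable_on h \<Omega>" and \<Omega>: "open \<Omega>"
    and z: "\<And>\<phi>. \<phi> \<in> test_functions \<Omega> \<Longrightarrow> (\<integral>x. h x * \<phi> x \<partial>lebesgue_on \<Omega>) = 0"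
  shows "AE x in lebesgue_on \<Omega>. h x = 0"
proof -
  obtain \<D> where \<D>: "countable \<D>" "\<D> \<subseteq> Pow \<Omega>" "\<And>X. X \<in> \<D> \<Longrightarrow> \<exists>a b. X = cbox a b" "\<Union>\<D> = \<Omega>"
    using open_countable_Union_open_cbox[OF \<Omega>] by metis
  have "AE x in lebesgue. \<forall>X\<in>\<D>. x \<in> X \<longrightarrow> h x = 0"
    unfolding AE_ball_countable[OF \<D>(1)]
  proof
    fix X assume "X \<in> \<D>"
    moreover from this obtain a b where "X = cbox a b" using \<D>(3) by blast
    ultimately show "AE x in lebesgue. x \<in> X \<longrightarrow> h x = 0"
      using AE_zero_on_cbox[OF h \<Omega> z] \<D>(2) by blast
  qed
  then have "AE x in lebesgue. x \<in> \<Omega> \<longrightarrow> h x = 0"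
    by eventually_elim (use \<D>(4) in blast)
  then show ?thesis using \<Omega> by (subst AE_restrict_space_iff) auto
qed

lemma has_weak_deriv_unique:
  assumes g: "has_weak_deriv \<Omega> \<alpha> f g" and g': "has_weak_deriv \<Omega> \<alpha> f g'" and \<Omega>: "open \<Omega>"
  shows "AE x in lebesgue_on \<Omega>. g x = g' x"
proof -
  have l: "locally_integrable_on g \<Omega>" "locally_integrable_on g' \<Omega>"
    using g g' by (auto simp: has_weak_deriv_def)
  have "AE x in lebesgue_on \<Omega>. g x - g' x = 0"
  proof (rule AE_zero_if_orthogonal_to_test_functions[OF _ \<Omega>])
    show "locally_integrable_on (\<lambda>x. g x - g' x) \<Omega>"
      using l by (auto simp: locally_integrable_on_def)
    fix \<phi> assume \<phi>: "\<phi> \<in> test_functions \<Omega>"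
    have "(\<integral>x. g x * \<phi> x \<partial>lebesgue_on \<Omega>) = (\<integral>x. g' x * \<phi> x \<partial>lebesgue_on \<Omega>)"
      using g g' \<phi> by (auto simp: has_weak_deriv_def)
    then show "(\<integral>x. (g x - g' x) * \<phi> x \<partial>lebesgue_on \<Omega>) = 0"
      using locally_integrable_times_test_function[OF _ \<phi> \<Omega>] l by (simp add: left_diff_distrib)
  qed
  then show ?thesis by simp
qed

text \<open>Existence of one weak derivative makes the choice behind \<open>weak_deriv\<close> a
  genuine weak derivative; uniqueness then ties it to \<open>g\<close>.\<close>

lemma weak_deriv_AE_eq:
  assumes "has_weak_deriv \<Omega> \<alpha> f g" "open \<Omega>"
  shows "AE x in lebesgue_on \<Omega>. weak_deriv \<Omega> \<alpha> f x = g x"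
  using has_weak_deriv_unique[OF someI[of "has_weak_deriv \<Omega> \<alpha> f", OF assms(1)] assms]
  by (simp add: weak_deriv_def)

text \<open>By Schwarz's theorem for test functions both lists define the same predicate on
  candidates, so the choice operator returns the same function. The equality is therefore exact and
  not merely almost everywhere.\<close>

lemma weak_deriv_commute: "weak_deriv \<Omega> [i, j] f = weak_deriv \<Omega> [j, i] f"
proof -
  have "has_weak_deriv \<Omega> [i, j] f = has_weak_deriv \<Omega> [j, i] f"
    using partials_commute[of _ i j]
    by (auto simp: has_weak_deriv_def test_functions_def fun_eq_iff simp del: partials.simps)
  then show ?thesis by (simp add: weak_deriv_def)
qed

section \<open>The two-wave saddle\<close>

text \<open>The mixed entry is listed as \<open>[2, 1]\<close> because the weak derivative along
  \<open>[1, 2]\<close> is represented by the reversed list.\<close>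

lemma partials_two_wave_saddle:
  "partials [1, 1] two_wave_saddle = (\<lambda>x. 1)"
  "partials [2, 1] two_wave_saddle = (\<lambda>x. 0)"
  "partials [2, 2] two_wave_saddle = (\<lambda>x. -1)"
proof -
  have "(two_wave_saddle has_derivative (\<lambda>h. x $ 1 * h $ 1 - x $ 2 * h $ 2)) (at x)" for x
    unfolding two_wave_saddle_def[abs_def]
    by (auto intro!: derivative_eq_intros bounded_linear_imp_has_derivative bounded_linear_vec_nth
        simp: field_simps)
  from partial_eqI[OF this] 
  have p: "partial 1 two_wave_saddle = (\<lambda>x. x $ 1)" "partial 2 two_wave_saddle = (\<lambda>x. - x $ 2)"
    by (auto simp: fun_eq_iff axis_def)
  have "((\<lambda>x. - x $ 2) has_derivative (\<lambda>h. - h $ 2)) (at x)" for x :: "real^2"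
    by (intro has_derivative_minus bounded_linear_imp_has_derivative bounded_linear_vec_nth)
  from partial_eqI[OF this] 
  have q: "partial i (\<lambda>x::real^2. - x $ 2) = (\<lambda>x. if i = 2 then -1 else 0)" for i
    by (auto simp: fun_eq_iff axis_def)
  show "partials [1, 1] two_wave_saddle = (\<lambda>x. 1)"
    "partials [2, 1] two_wave_saddle = (\<lambda>x. 0)"
    "partials [2, 2] two_wave_saddle = (\<lambda>x. -1)"
    by (simp_all add: p q partial_coord)
qed

text \<open>The algebra built for the cutoffs contains all polynomials in the coordinates, so its
  smoothness result applies here too.\<close>

lemma smooth_two_wave_saddle: "smooth two_wave_saddle"
proof (rule flat_algebra_smooth)
  have "(\<lambda>x::real^2. (1/2) * (x $ 1 * x $ 1) + (- 1/2) * (x $ 2 * x $ 2)) \<in> flat_algebra"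
    by (intro flat_algebra.intros)
  moreover have "(\<lambda>x::real^2. (1/2) * (x $ 1 * x $ 1) + (- 1/2) * (x $ 2 * x $ 2)) = two_wave_saddle"
    by (simp add: fun_eq_iff two_wave_saddle_def power2_eq_square)
  ultimately show "two_wave_saddle \<in> flat_algebra" by simp
qed

lemma integrable_lebesgue_on_subset:
  fixes f :: "'a::euclidean_space \<Rightarrow> real"
  assumes f: "integrable (lebesgue_on T) f" and "S \<subseteq> T" and S: "S \<in> sets lebesgue" and T: "T \<in> sets lebesgue"
  shows "integrable (lebesgue_on S) f"
proof -
  have "integrable lebesgue (\<lambda>x. indicator T x *\<^sub>R f x)"
    using f T integrable_restrict_space[of T lebesgue f] by simp
  from integrable_mult_indicator[OF S this]
  have "integrable lebesgue (\<lambda>x. indicator S x *\<^sub>R (indicator T x *\<^sub>R f x))" .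
  moreover have "(\<lambda>x. indicator S x *\<^sub>R (indicator T x *\<^sub>R f x)) = (\<lambda>x. indicator S x *\<^sub>R f x)"
    using \<open>S \<subseteq> T\<close> by (auto simp: indicator_def fun_eq_iff)
  ultimately show ?thesis
    using S by (subst integrable_restrict_space) auto
qed

text \<open>The open ball is not compact, so integrability is obtained on the closed ball and
  restricted.\<close>

lemma L2_on_ball_continuous:
  fixes f :: "real^'n::finite \<Rightarrow> real"
  assumes c: "continuous_on UNIV f"
  shows "f \<in> L2_on (ball a r)"
proof -
  have "integrable (lebesgue_on (cball a r)) (\<lambda>x. (f x)\<^sup>2)"
    by (intro integrable_lebesgue_on_compact continuous_on_power c) simp
  then have "integrable (lebesgue_on (ball a r)) (\<lambda>x. (f x)\<^sup>2)"
    by (rule integrable_lebesgue_on_subset) auto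
  moreover have "f \<in> borel_measurable (lebesgue_on (ball a r))"
    by (intro continuous_imp_measurable_on_sets_lebesgue continuous_on_subset[OF c]) auto
  ultimately show ?thesis by (simp add: L2_on_def)
qed

lemma smooth_sobolev_W2_ball:
  assumes "smooth f"
  shows "f \<in> sobolev_W2 k (ball a r)"
proof -
  have "partials \<alpha> f \<in> L2_on (ball a r)" for \<alpha>
    by (intro L2_on_ball_continuous smooth_continuous_on assms)
  moreover from this[of "[]"] have "f \<in> L2_on (ball a r)" by simp
  moreover have "has_weak_deriv (ball a r) \<alpha> f (partials (rev \<alpha>) f)" for \<alpha>
    by (intro smooth_has_weak_deriv assms open_ball)
  ultimately show ?thesis unfolding sobolev_W2_def by blast
qed

lemma weak_deriv_two_wave_saddle:
  "AE x in lebesgue_on (ball 0 R). weak_deriv (ball 0 R) [1, 1] two_wave_saddle x = 1"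
  "AE x in lebesgue_on (ball 0 R). weak_deriv (ball 0 R) [1, 2] two_wave_saddle x = 0"
  "AE x in lebesgue_on (ball 0 R). weak_deriv (ball 0 R) [2, 2] two_wave_saddle x = -1"
proof -
  have w: "AE x in lebesgue_on (ball 0 R). weak_deriv (ball 0 R) \<alpha> two_wave_saddle x
      = partials (rev \<alpha>) two_wave_saddle x" for \<alpha>
    by (intro weak_deriv_AE_eq smooth_has_weak_deriv smooth_two_wave_saddle open_ball)
  show "AE x in lebesgue_on (ball 0 R). weak_deriv (ball 0 R) [1, 1] two_wave_saddle x = 1"
    "AE x in lebesgue_on (ball 0 R). weak_deriv (ball 0 R) [1, 2] two_wave_saddle x = 0"
    "AE x in lebesgue_on (ball 0 R). weak_deriv (ball 0 R) [2, 2] two_wave_saddle x = -1"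
    using w[of "[1, 1]"] w[of "[1, 2]"] w[of "[2, 2]"]
    by (simp_all add: partials_two_wave_saddle del: partials.simps)
qed

section \<open>The energy estimate\<close>

lemma norm_weak_hessian:
  fixes \<omega> :: "real^2 \<Rightarrow> real"
  shows "(norm (weak_hessian \<Omega> \<omega> x))\<^sup>2 =
    (weak_deriv \<Omega> [1, 1] \<omega> x)\<^sup>2 + 2 * (weak_deriv \<Omega> [1, 2] \<omega> x)\<^sup>2 + (weak_deriv \<Omega> [2, 2] \<omega> x)\<^sup>2"
  by (simp add: norm_matrix_frobenius weak_hessian_def sum_2 weak_deriv_commute[of \<Omega> 2 1])

text \<open>The Sobolev condition supplies some square integrable weak derivative, not the chosen
  one; the two agree almost everywhere, and measurability and integrability carry over.\<close>

lemma weak_deriv_square_integrable: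
  assumes "\<omega> \<in> sobolev_W2 k \<Omega>" "length \<alpha> \<le> k" "open \<Omega>"
  shows "integrable (lebesgue_on \<Omega>) (\<lambda>x. (weak_deriv \<Omega> \<alpha> \<omega> x)\<^sup>2)"
proof -
  obtain g where g: "g \<in> L2_on \<Omega>" "has_weak_deriv \<Omega> \<alpha> \<omega> g"
    using assms by (auto simp: sobolev_W2_def)
  have eq: "AE x in lebesgue_on \<Omega>. weak_deriv \<Omega> \<alpha> \<omega> x = g x"
    by (rule weak_deriv_AE_eq[OF g(2) assms(3)])
  have m: "g \<in> borel_measurable (lebesgue_on \<Omega>)" and i: "integrable (lebesgue_on \<Omega>) (\<lambda>x. (g x)\<^sup>2)"
    using g(1) by (auto simp: L2_on_def)
  have "weak_deriv \<Omega> \<alpha> \<omega> \<in> borel_measurable (lebesgue_on \<Omega>)"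
  proof -
    have S: "\<Omega> \<in> sets lebesgue" using assms(3) by simp
    then have "AE x in lebesgue. x \<in> \<Omega> \<longrightarrow> weak_deriv \<Omega> \<alpha> \<omega> x = g x"
      using eq AE_restrict_space_iff[of \<Omega> lebesgue] by simp
    \<comment> \<open>Measurability passes to an almost everywhere equal function by completeness of
      \<open>lebesgue\<close>; extension by zero moves the question from \<Omega> to the whole
      space.\<close>
    then have "AE x in lebesgue. (if x \<in> \<Omega> then g x else 0) = (if x \<in> \<Omega> then weak_deriv \<Omega> \<alpha> \<omega> x else 0)"
      by eventually_elim simp
    from borel_measurable_AE[OF borel_measurable_if_I[OF m S] this] show ?thesis
      by (rule borel_measurable_if_D)
  qed
  then show ?thesis
    using eq by (intro integrable_cong_AE_imp[OF i]) (auto elim: eventually_mono)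
qed

theorem mainTheorem4:
  fixes R :: real
  assumes "R > 0"
  shows "two_wave_saddle \<in> sobolev_W2 2 (ball 0 R) \<and>
         solves_monge_ampere R two_wave_saddle \<and>
         (\<forall>\<omega>\<in>sobolev_W2 2 (ball 0 R).
            solves_monge_ampere R \<omega> \<longrightarrow>
            bending_energy R two_wave_saddle \<le> bending_energy R \<omega>)"
proof (intro conjI ballI impI)
  show "two_wave_saddle \<in> sobolev_W2 2 (ball 0 R)"
    by (intro smooth_sobolev_W2_ball smooth_two_wave_saddle)
  show "solves_monge_ampere R two_wave_saddle"
    unfolding solves_monge_ampere_def
    using weak_deriv_two_wave_saddle[of R] by eventually_elim simp
  fix \<omega> assume \<omega>: "\<omega> \<in> sobolev_W2 2 (ball 0 R)" and ma: "solves_monge_ampere R \<omega>"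
  \<comment> \<open>Monotonicity of the integral needs both energies to be genuine integrals and not
    the default value 0.\<close>
  have int: "integrable (lebesgue_on (ball 0 R)) (\<lambda>x. (norm (weak_hessian (ball 0 R) f x))\<^sup>2)"
    if "f \<in> sobolev_W2 2 (ball 0 R)" for f :: "real^2 \<Rightarrow> real"
    unfolding norm_weak_hessian
    by (intro Bochner_Integration.integrable_add integrable_mult_right weak_deriv_square_integrable[OF that]) auto
  have "AE x in lebesgue_on (ball 0 R). (norm (weak_hessian (ball 0 R) two_wave_saddle x))\<^sup>2
      \<le> (norm (weak_hessian (ball 0 R) \<omega> x))\<^sup>2"
    using weak_deriv_two_wave_saddle[of R] ma[unfolded solves_monge_ampere_def]
  proof eventually_elim
    case (elim x)
    let ?d = "\<lambda>\<alpha>. weak_deriv (ball 0 R) \<alpha> \<omega> x"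
    have "(norm (weak_hessian (ball 0 R) two_wave_saddle x))\<^sup>2 = 2"
      using elim by (simp add: norm_weak_hessian)
    \<comment> \<open>Doubling the Monge-Ampere equation turns twice the squared mixed term into
      twice the product of the pure second derivatives plus 2, which completes the square.\<close>
    moreover have "(norm (weak_hessian (ball 0 R) \<omega> x))\<^sup>2 = (?d [1, 1] + ?d [2, 2])\<^sup>2 + 2"
      using elim(4) unfolding norm_weak_hessian by (simp add: power2_eq_square algebra_simps)
    ultimately show ?case by simp
  qed
  then show "bending_energy R two_wave_saddle \<le> bending_energy R \<omega>"
    unfolding bending_energy_def
    by (intro integral_mono_AE int \<omega> smooth_sobolev_W2_ball smooth_two_wave_saddle)
qed

end
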